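(* Let $X$ be a real Banach space, let $C\subset X$ be a (nonempty) bounded closed convex set and let $f:C\to\mathbb R$ be a uniformly continuous function. Consider the following numbers: $(\varepsilon_1)$ the infimum of the $\varepsilon>0$ such that $\mathrm{Dz}(f,\varepsilon)<\omega$; $(\varepsilon_2)$ the infimum of the $\varepsilon>0$ such that there exists a $\mathcal{DC}$-Lipschitz function $g$ on $C$ with $\|f-g\|_C<\varepsilon$. Then $\varepsilon_1/2\le\varepsilon_2\le2\varepsilon_1$.
   Context: $\|\cdot\|_C$ is the supremum norm on $C$. A real function on $C$ is $\mathcal{DC}$-Lipschitz if it is the difference of two convex Lipschitz functions defined on $C$. For a closed convex set $D\subset C$ and $\varepsilon>0$ put $$[D]'_\varepsilon=\{x\in D:\ \operatorname{diam}(f(D\cap H))>\varepsilon\ \text{ for every open halfspace } H \text{ of } X \text{ with } x\in H\}$$ (diameters in $\mathbb R$ with the usual metric), $[C]^0_\varepsilon=C$, and $[C]^n_\varepsilon=[[C]^{n-1}_\varepsilon]'_\varepsilon$ for $n\in\mathbb N$. If there is $n\in\mathbb N$ with $[C]^{n-1}_\varepsilon\ne\emptyset$ and $[C]^n_\varepsilon=\emptyset$, then $\mathrm{Dz}(f,\varepsilon)=n$; "$\mathrm{Dz}(f,\varepsilon)<\omega$" means that such a finite $n$ exists. *)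

theory Defs
  imports "HOL-Analysis.Analysis"
begin

(* The zero functional is admitted, so that the whole space counts as an open halfspace.
   Without this the trivial space X = {0} would have no open halfspace at all and the
   derivation below would never remove a point. On every space with a nonzero bounded
   functional the derivation is the same with or without the zero functional; see
   dz_derivation_nonzero. *)
definition open_halfspace :: "'a::real_normed_vector set \<Rightarrow> bool" where
  "open_halfspace H \<longleftrightarrow> (\<exists>\<phi> a. bounded_linear \<phi> \<and> H = {x. \<phi> x < (a::real)})"

definition dz_derivation ::
    "('a::real_normed_vector \<Rightarrow> real) \<Rightarrow> real \<Rightarrow> 'a set \<Rightarrow> 'a set" where
  "dz_derivation f \<epsilon> D =
     {x \<in> D. \<forall>H. open_halfspace H \<and> x \<in> H \<longrightarrow> diameter (f ` (D \<inter> H)) > \<epsilon>}"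

lemma dz_derivation_nonzero:
  fixes f :: "'a::real_normed_vector \<Rightarrow> real"
  assumes bdd: "bounded (f ` D)"
    and nz: "bounded_linear (\<phi>\<^sub>0 :: 'a \<Rightarrow> real)" "\<phi>\<^sub>0 z \<noteq> 0"
  shows "dz_derivation f \<epsilon> D =
    {x \<in> D. \<forall>H. (\<exists>\<phi> a. bounded_linear \<phi> \<and> (\<exists>y. \<phi> y \<noteq> 0) \<and> H = {x. \<phi> x < (a::real)}) \<and> x \<in> H
        \<longrightarrow> diameter (f ` (D \<inter> H)) > \<epsilon>}" (is "_ = ?R")
proof
  show "dz_derivation f \<epsilon> D \<subseteq> ?R"
    unfolding dz_derivation_def open_halfspace_def by blast
  show "?R \<subseteq> dz_derivation f \<epsilon> D"
  proof
    fix x assume x: "x \<in> ?R"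
    have "diameter (f ` (D \<inter> H)) > \<epsilon>" if H: "open_halfspace H" "x \<in> H" for H
    proof -
      obtain \<phi> a where \<phi>: "bounded_linear \<phi>" "H = {x. \<phi> x < (a::real)}"
        using H(1) unfolding open_halfspace_def by blast
      show ?thesis
      proof (cases "\<exists>y. \<phi> y \<noteq> 0")
        case True
        then show ?thesis using x \<phi> H(2) by blast
      next
        case False
        then have "H = UNIV" using \<phi>(2) H(2) by (auto split: if_splits)
        let ?K = "{y. \<phi>\<^sub>0 y < \<phi>\<^sub>0 x + 1}"
        have "x \<in> ?K" by simp
        then have "diameter (f ` (D \<inter> ?K)) > \<epsilon>" using x nz by blast
        also have "diameter (f ` (D \<inter> ?K)) \<le> diameter (f ` D)"
          by (rule diameter_subset) (use bdd in auto)
        finally show ?thesis using \<open>H = UNIV\<close> by simp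
      qed
    qed
    then show "x \<in> dz_derivation f \<epsilon> D"
      using x unfolding dz_derivation_def by blast
  qed
qed

definition dz_iter ::
    "('a::real_normed_vector \<Rightarrow> real) \<Rightarrow> real \<Rightarrow> 'a set \<Rightarrow> nat \<Rightarrow> 'a set" where
  "dz_iter f \<epsilon> C n = (dz_derivation f \<epsilon> ^^ n) C"

(* Dz(f, \<epsilon>) is a partial function of \<epsilon>, so "Dz(f, \<epsilon>) = n" is rendered as a relation. *)
definition Dz_eq ::
    "'a::real_normed_vector set \<Rightarrow> ('a \<Rightarrow> real) \<Rightarrow> real \<Rightarrow> nat \<Rightarrow> bool" where
  "Dz_eq C f \<epsilon> n \<longleftrightarrow> n \<ge> 1 \<and> dz_iter f \<epsilon> C (n - 1) \<noteq> {} \<and> dz_iter f \<epsilon> C n = {}"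

definition Dz_finite :: "'a::real_normed_vector set \<Rightarrow> ('a \<Rightarrow> real) \<Rightarrow> real \<Rightarrow> bool" where
  "Dz_finite C f \<epsilon> \<longleftrightarrow> (\<exists>n. Dz_eq C f \<epsilon> n)"

definition DC_Lipschitz_on :: "'a::real_normed_vector set \<Rightarrow> ('a \<Rightarrow> real) \<Rightarrow> bool" where
  "DC_Lipschitz_on C g \<longleftrightarrow>
     (\<exists>u v. convex_on C u \<and> (\<exists>L. L-lipschitz_on C u) \<and>
            convex_on C v \<and> (\<exists>L. L-lipschitz_on C v) \<and>
            (\<forall>x\<in>C. g x = u x - v x))"

(* Meaningful for C nonempty and h bounded on C. *)
definition sup_norm_on :: "'a set \<Rightarrow> ('a \<Rightarrow> real) \<Rightarrow> real" where
  "sup_norm_on C h = (SUP x\<in>C. \<bar>h x\<bar>)"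

(* For C nonempty, bounded and convex and f uniformly continuous on C, f is bounded on C.
   Hence all diameters and suprema here are those of bounded sets, and the two sets whose
   infimum is taken are nonempty (every \<epsilon> > diameter (f ` C) lies in the first; g = 0
   shows that the second contains every large \<epsilon>). *)
definition eps1 :: "'a::real_normed_vector set \<Rightarrow> ('a \<Rightarrow> real) \<Rightarrow> real" where
  "eps1 C f = Inf {\<epsilon>. \<epsilon> > 0 \<and> Dz_finite C f \<epsilon>}"

definition eps2 :: "'a::real_normed_vector set \<Rightarrow> ('a \<Rightarrow> real) \<Rightarrow> real" where
  "eps2 C f = Inf {\<epsilon>. \<epsilon> > 0 \<and> (\<exists>g. DC_Lipschitz_on C g \<and> sup_norm_on C (\<lambda>x. f x - g x) < \<epsilon>)}"

end

theory Submission
  imports Defs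
begin

text \<open>
  Finite dentability and \<open>DC\<close>-Lipschitz approximation meet in one notion. For a convex
  function \<open>h\<close> put \<open>gap(x, y) = (h x + h y) / 2 - h ((x + y) / 2) \<ge> 0\<close>, and say that
  \<open>f\<close> is gap-controlled at level \<open>r\<close> if for some convex Lipschitz \<open>h\<close> and some \<open>\<eta> > 0\<close> a gap
  below \<open>\<eta>\<close> forces \<open>\<bar>f x - f y\<bar> \<le> r\<close>. The numbers \<open>\<epsilon>\<close> of the two infima are compared with the
  levels of gap control by four implications.

  \<^item> Control at \<open>r\<close> gives \<open>Dz(f, r) < \<omega>\<close>. If \<open>h \<le> s\<close> on \<open>D\<close>, a point of \<open>D\<close> with
    \<open>h > s - \<eta>\<close> lies in a halfspace that misses \<open>{h \<le> s - \<eta>}\<close>. Any two points of that slice of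
    \<open>D\<close> have their midpoint in it, so their gap is below \<open>\<eta>\<close> and the point is removed. Each
    derivation thus lowers the bound \<open>s\<close> by \<open>\<eta>\<close>.

  \<^item> If \<open>g = u - v\<close> is \<open>DC\<close>-Lipschitz with \<open>\<parallel>f - g\<parallel> < \<epsilon>\<close>, then \<open>f\<close> is controlled at
    \<open>2 \<epsilon>\<close>: after making \<open>u, v \<ge> 0\<close> take \<open>h = u\<^sup>2 + v\<^sup>2\<close>, whose gap is at least
    \<open>((u x - u y)\<^sup>2 + (v x - v y)\<^sup>2) / 4\<close>.

  \<^item> If \<open>Dz(f, \<epsilon>) < \<omega>\<close>, then \<open>f\<close> is controlled at \<open>2 \<epsilon> + \<delta>\<close> for every \<open>\<delta> > 0\<close>. Here
    \<open>h\<close> is the sum of \<open>d\<^sup>2 + d\<close> over the distance functions \<open>d\<close> to the nonempty derived sets. A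
    small gap makes every such \<open>d\<close> almost constant along the segment, which therefore runs, up to
    a small displacement, inside one layer \<open>D - D'\<close> of the derivation. Each point of a segment in
    such a layer has a slice of oscillation at most \<open>\<epsilon>\<close> that contains one of the endpoints, and
    connectedness produces a point that is \<open>\<epsilon>\<close>-close in value to both. Uniform continuity
    absorbs the displacement into \<open>\<delta>\<close>.

  \<^item> Control at \<open>r\<close> gives a \<open>DC\<close>-Lipschitz \<open>g\<close> with \<open>\<parallel>f - g\<parallel> \<le> r\<close>, namely the
    inf-convolution \<open>g x = inf\<^sub>y (f y + k gap(x, y))\<close> with \<open>k\<close> large. Pulling \<open>k h x / 2\<close> out of the
    infimum leaves minus a supremum of convex Lipschitz functions of \<open>x\<close>.

  The first implication needs to separate a point from a closed convex set in a general normed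
  space; this is derived from the Hahn-Banach theorem, which is proved here by way of minimal
  sublinear functionals.
\<close>

section \<open>Hahn-Banach separation\<close>

definition sublinear :: "('a::real_vector \<Rightarrow> real) \<Rightarrow> bool" where
  "sublinear p \<longleftrightarrow> p 0 = 0 \<and> (\<forall>x y. p (x + y) \<le> p x + p y) \<and> (\<forall>t>0. \<forall>x. p (t *\<^sub>R x) \<le> t * p x)"

lemma sublinear_zero: "sublinear p \<Longrightarrow> p 0 = 0"
  by (simp add: sublinear_def)

lemma sublinear_add: "sublinear p \<Longrightarrow> p (x + y) \<le> p x + p y"
  by (simp add: sublinear_def)

lemma sublinear_scaleR:
  assumes "sublinear p" "0 \<le> t"
  shows "p (t *\<^sub>R x) = t * p x"
proof (cases "t = 0")
  case False
  then have t: "t > 0" using assms(2) by simp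
  have "p x \<le> (1/t) * p (t *\<^sub>R x)"
    using assms(1) t unfolding sublinear_def
    by (metis (no_types, lifting) divide_self less_numeral_extra(3) scaleR_one scaleR_scaleR times_divide_eq_left mult_1 zero_less_divide_1_iff)
  then have "t * p x \<le> p (t *\<^sub>R x)" using t by (simp add: field_simps)
  moreover have "p (t *\<^sub>R x) \<le> t * p x" using assms(1) t unfolding sublinear_def by blast
  ultimately show ?thesis by simp
qed (use assms in \<open>simp add: sublinear_zero\<close>)

lemma sublinear_minus: "sublinear p \<Longrightarrow> - p (- x) \<le> p x"
  using sublinear_add[of p x "- x"] sublinear_zero[of p] by simp

text \<open>
  The formula \<open>p x = inf {q (x + t e) - t c | t \<ge> 0, e \<in> E}\<close> defines \<open>p\<close>: convexity of \<open>E\<close> makes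
  it subadditive, and \<open>c \<le> q\<close> on \<open>E\<close> keeps it above \<open>- q (- x)\<close>. The lemma is used twice: with \<open>E\<close> a
  single point, to show that a minimal sublinear functional is odd, and with \<open>q\<close> the norm, to encode
  a separation problem in a sublinear functional.
\<close>
lemma sublinear_lower_on_convex:
  fixes q :: "'a::real_vector \<Rightarrow> real"
  assumes q: "sublinear q" and E: "convex E" "E \<noteq> {}" and c: "\<And>e. e \<in> E \<Longrightarrow> c \<le> q e"
  obtains p where "sublinear p" "\<And>x. p x \<le> q x" "\<And>e. e \<in> E \<Longrightarrow> p (- e) \<le> - c"
proof -
  define F where "F x = (\<lambda>(t, e). q (x + t *\<^sub>R e) - t * c) ` ({0..} \<times> E)" for x
  define p where "p x = Inf (F x)" for x
  have F_I: "q (x + t *\<^sub>R e) - t * c \<in> F x" if "t \<ge> 0" "e \<in> E" for x t e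
    using that unfolding F_def by force
  have F_ne: "F x \<noteq> {}" for x
    using E(2) unfolding F_def by (simp add: times_eq_iff)
  have F_E: "\<exists>t e. t \<ge> 0 \<and> e \<in> E \<and> s = q (x + t *\<^sub>R e) - t * c" if "s \<in> F x" for s x
    using that unfolding F_def by auto
  have lower: "- q (- x) \<le> s" if s: "s \<in> F x" for x s
  proof -
    obtain t e where te: "t \<ge> 0" "e \<in> E" "s = q (x + t *\<^sub>R e) - t * c" using F_E[OF s] by blast
    have "t * c \<le> t * q e" using te c by (simp add: mult_left_mono)
    also have "\<dots> = q ((x + t *\<^sub>R e) + - x)" using sublinear_scaleR[OF q te(1)] by simp
    also have "\<dots> \<le> q (x + t *\<^sub>R e) + q (- x)" by (rule sublinear_add[OF q])
    finally show ?thesis using te by simp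
  qed
  have p_le: "p x \<le> q (x + t *\<^sub>R e) - t * c" if "t \<ge> 0" "e \<in> E" for x t e
    unfolding p_def using F_I[OF that] lower by (intro cInf_lower bdd_belowI)
  have p_ge: "b \<le> p x" if "\<And>t e. t \<ge> 0 \<Longrightarrow> e \<in> E \<Longrightarrow> b \<le> q (x + t *\<^sub>R e) - t * c" for b x
    unfolding p_def using F_ne F_E that by (intro cInf_greatest) blast+
  have p_q: "p x \<le> q x" for x using p_le[of 0 _ x] E(2) by auto
  have p_E: "p (- e) \<le> - c" if "e \<in> E" for e
    using p_le[of 1 e "- e"] that sublinear_zero[OF q] by simp
  have p0: "p 0 = 0"
  proof (rule antisym)
    show "p 0 \<le> 0" using p_q[of 0] sublinear_zero[OF q] by simp
    show "0 \<le> p 0"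
      using c sublinear_scaleR[OF q] by (intro p_ge) (auto simp: mult_left_mono)
  qed
  have p_scale: "p (t *\<^sub>R x) \<le> t * p x" if t: "t > 0" for t x
  proof -
    have "p (t *\<^sub>R x) / t \<le> p x"
    proof (rule p_ge)
      fix s e assume se: "(s::real) \<ge> 0" "e \<in> E"
      have "p (t *\<^sub>R x) \<le> q (t *\<^sub>R x + (t * s) *\<^sub>R e) - (t * s) * c"
        using se t by (intro p_le) auto
      also have "t *\<^sub>R x + (t * s) *\<^sub>R e = t *\<^sub>R (x + s *\<^sub>R e)" by (simp add: scaleR_add_right)
      also have "q \<dots> = t * q (x + s *\<^sub>R e)" using sublinear_scaleR[OF q] t by simp
      finally show "p (t *\<^sub>R x) / t \<le> q (x + s *\<^sub>R e) - s * c" using t by (simp add: field_simps)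
    qed
    then show ?thesis using t by (simp add: field_simps)
  qed
  have p_add: "p (x + y) \<le> p x + p y" for x y
  proof -
    have *: "p (x + y) \<le> (q (x + s *\<^sub>R a) - s * c) + (q (y + t *\<^sub>R b) - t * c)"
      if st: "s \<ge> 0" "t \<ge> 0" "a \<in> E" "b \<in> E" for s t a b
    proof -
      \<comment> \<open>Convexity of \<open>E\<close> merges the two rays into one.\<close>
      obtain e where e: "e \<in> E" "(s + t) *\<^sub>R e = s *\<^sub>R a + t *\<^sub>R b"
      proof (cases "s + t = 0")
        case True
        then have "s = 0" "t = 0" using st by linarith+
        then show ?thesis using that[of a] st by simp
      next
        case False
        have "(s / (s + t)) *\<^sub>R a + (t / (s + t)) *\<^sub>R b \<in> E"
          using E(1) st False by (intro convexD) (auto simp: add_divide_distrib[symmetric])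
        then show ?thesis using that False by (simp add: scaleR_add_right)
      qed
      have "p (x + y) \<le> q ((x + y) + (s + t) *\<^sub>R e) - (s + t) * c" using st e by (intro p_le) auto
      also have "(x + y) + (s + t) *\<^sub>R e = (x + s *\<^sub>R a) + (y + t *\<^sub>R b)" using e by simp
      also have "q \<dots> \<le> q (x + s *\<^sub>R a) + q (y + t *\<^sub>R b)" by (rule sublinear_add[OF q])
      finally show ?thesis by (simp add: algebra_simps)
    qed
    have "p (x + y) - (q (y + t *\<^sub>R b) - t * c) \<le> p x" if "t \<ge> 0" "b \<in> E" for t b
      using *[OF _ that(1) _ that(2)] by (intro p_ge) (simp add: algebra_simps)
    then have "p (x + y) - p x \<le> p y" by (intro p_ge) (simp add: algebra_simps)
    then show ?thesis by simp
  qed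
  show ?thesis
    using that[of p] p0 p_add p_scale p_q p_E unfolding sublinear_def by blast
qed

text \<open>
  A common upper bound \<open>p\<close> gives a common lower bound \<open>- p (- x)\<close>, so the pointwise infimum is
  finite; it is subadditive because of two members of a chain one can use the smaller.
\<close>
lemma sublinear_Inf_chain:
  fixes K :: "('a::real_vector \<Rightarrow> real) set"
  assumes K: "\<And>q. q \<in> K \<Longrightarrow> sublinear q" "\<And>q. q \<in> K \<Longrightarrow> q \<le> p" "K \<noteq> {}"
    and chain: "\<And>q r. q \<in> K \<Longrightarrow> r \<in> K \<Longrightarrow> q \<le> r \<or> r \<le> q"
  obtains u where "sublinear u" "\<And>q. q \<in> K \<Longrightarrow> u \<le> q"
proof -
  define u where "u x = (INF q\<in>K. q x)" for x
  have lower: "- p (- x) \<le> q x" if "q \<in> K" for q x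
    using sublinear_minus[OF K(1)[OF that], of x] K(2)[OF that] by (force simp: le_fun_def dest: spec[of _ "- x"])
  have u_le: "u x \<le> q x" if "q \<in> K" for q x
    unfolding u_def using that lower by (intro cINF_lower bdd_belowI2) auto
  have u_ge: "b \<le> u x" if "\<And>q. q \<in> K \<Longrightarrow> b \<le> q x" for b x
    unfolding u_def using K(3) that by (intro cINF_greatest) auto
  obtain q0 where q0: "q0 \<in> K" using K(3) by blast
  have "u 0 = 0"
    using u_le[OF q0, of 0] u_ge[of 0 0] sublinear_zero[OF K(1)] q0 by force
  moreover have "u (x + y) \<le> u x + u y" for x y
  proof -
    have *: "u (x + y) \<le> q x + r y" if qr: "q \<in> K" "r \<in> K" for q r
    proof -
      obtain s where s: "s \<in> K" "s \<le> q" "s \<le> r" using chain[OF qr] qr by blast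
      have "u (x + y) \<le> s x + s y" using u_le[OF s(1)] sublinear_add[OF K(1)[OF s(1)]] order_trans by blast
      also have "\<dots> \<le> q x + r y" using s by (simp add: le_fun_def add_mono)
      finally show ?thesis .
    qed
    have "u (x + y) - r y \<le> u x" if "r \<in> K" for r
      using *[OF _ that] by (intro u_ge) (simp add: algebra_simps)
    then have "u (x + y) - u x \<le> u y" by (intro u_ge) (simp add: algebra_simps)
    then show ?thesis by simp
  qed
  moreover have "u (t *\<^sub>R x) \<le> t * u x" if t: "t > 0" for t x
  proof -
    have "u (t *\<^sub>R x) / t \<le> u x"
    proof (rule u_ge)
      fix q assume q: "q \<in> K"
      show "u (t *\<^sub>R x) / t \<le> q x"
        using u_le[OF q, of "t *\<^sub>R x"] sublinear_scaleR[OF K(1)[OF q], of t x] t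
        by (simp add: field_simps)
    qed
    then show ?thesis using t by (simp add: field_simps)
  qed
  ultimately have "sublinear u" unfolding sublinear_def by blast
  then show ?thesis using that u_le by (simp add: le_fun_def)
qed

text \<open>
  Below \<open>p\<close> there is a minimal sublinear functional \<open>m\<close>. Lowering \<open>m\<close> at a single point \<open>- y\<close> as
  far as \<open>sublinear_lower_on_convex\<close> permits cannot change it, so \<open>m (- y) = - m y\<close>; an odd
  subadditive functional is additive.
\<close>
theorem Hahn_Banach_sublinear:
  fixes p :: "'a::real_vector \<Rightarrow> real"
  assumes p: "sublinear p"
  obtains \<phi> where "linear \<phi>" "\<And>x. \<phi> x \<le> p x"
proof -
  define S where "S = {q. sublinear q \<and> q \<le> p}"
  define P where "P = (\<lambda>q r :: 'a \<Rightarrow> real. r \<le> q)"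
  have "\<exists>m\<in>S. \<forall>q\<in>S. P m q \<longrightarrow> q = m"
  proof (rule predicate_Zorn)
    show "partial_order_on S (relation_of P S)"
      by (rule partial_order_on_relation_ofI) (auto simp: P_def)
    fix K assume K: "K \<in> Chains (relation_of P S)"
    show "\<exists>u\<in>S. \<forall>q\<in>K. P q u"
    proof (cases "K = {}")
      case True
      then show ?thesis using p by (auto simp: S_def)
    next
      case False
      have KS: "q \<in> S" if "q \<in> K" for q
        using K that unfolding Chains_def relation_of_def by blast
      have "q \<le> r \<or> r \<le> q" if "q \<in> K" "r \<in> K" for q r
        using K that unfolding Chains_def relation_of_def P_def by blast
      then obtain u where u: "sublinear u" "\<And>q. q \<in> K \<Longrightarrow> u \<le> q"
        using sublinear_Inf_chain[of K p] KS False unfolding S_def by blast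
      obtain q where "q \<in> K" using False by blast
      then have "u \<le> p" using u(2) KS unfolding S_def by (blast intro: order_trans)
      then show ?thesis using u by (auto simp: S_def P_def)
    qed
  qed
  then obtain m where m: "sublinear m" "m \<le> p" "\<And>q. sublinear q \<Longrightarrow> q \<le> m \<Longrightarrow> q = m"
    unfolding S_def P_def by (auto intro: order_trans)
  have odd: "m (- y) = - m y" for y
  proof -
    obtain q where q: "sublinear q" "\<And>x. q x \<le> m x" "q (- y) \<le> - m y"
      using sublinear_lower_on_convex[OF m(1), of "{y}" "m y"] by auto
    have "q = m" using q m(3) by (simp add: le_fun_def)
    then show ?thesis using q(3) sublinear_minus[OF m(1), of y] by simp
  qed
  have "linear m"
  proof (rule linearI)
    fix x y
    have "m (- x + - y) \<le> m (- x) + m (- y)" by (rule sublinear_add[OF m(1)])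
    then show "m (x + y) = m x + m y"
      using odd[of "x + y"] odd[of x] odd[of y] sublinear_add[OF m(1), of x y] by simp
  next
    fix t x
    show "m (t *\<^sub>R x) = t *\<^sub>R m x"
    proof (cases "t \<ge> 0")
      case True
      then show ?thesis using sublinear_scaleR[OF m(1)] by simp
    next
      case False
      then have "m ((- t) *\<^sub>R x) = (- t) * m x" using sublinear_scaleR[OF m(1), of "- t"] by simp
      then show ?thesis using odd[of "t *\<^sub>R x"] by simp
    qed
  qed
  then show ?thesis using that m(2) by (simp add: le_fun_def)
qed

text \<open>
  With \<open>x\<close> moved to the origin and \<open>d\<close> its distance to \<open>E\<close>, the norm can be lowered to a sublinear
  \<open>p\<close> with \<open>p (- e) \<le> - d\<close> on \<open>E\<close>. A linear functional below \<open>p\<close> is bounded by the norm and at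
  least \<open>d\<close> on \<open>E\<close>.
\<close>
theorem open_halfspace_separates_point:
  fixes E :: "'a::real_normed_vector set"
  assumes E: "closed E" "convex E" and x: "x \<notin> E"
  obtains H where "open_halfspace H" "x \<in> H" "H \<inter> E = {}"
proof (cases "E = {}")
  case True
  have "open_halfspace {y::'a. (0::real) < 1}"
    unfolding open_halfspace_def using bounded_linear_zero by blast
  then show ?thesis using that[of UNIV] True by simp
next
  case False
  define d where "d = infdist x E"
  have d: "d > 0" unfolding d_def using infdist_pos_not_in_closed[OF E(1) False x] .
  define E' where "E' = (\<lambda>e. e - x) ` E"
  have "convex E'" unfolding E'_def using E(2) by (rule convex_translation_subtract)
  moreover have "E' \<noteq> {}" using False unfolding E'_def by simp
  moreover have "d \<le> norm e" if "e \<in> E'" for e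
    using that infdist_le[of _ E x] unfolding E'_def d_def by (auto simp: dist_norm norm_minus_commute)
  moreover have "sublinear (norm :: 'a \<Rightarrow> real)"
    by (auto simp: sublinear_def norm_triangle_ineq)
  ultimately obtain p where p: "sublinear p" "\<And>z. p z \<le> norm z" "\<And>e. e \<in> E' \<Longrightarrow> p (- e) \<le> - d"
    using sublinear_lower_on_convex[of norm E' d] by metis
  obtain \<phi> where \<phi>: "linear \<phi>" "\<And>z. \<phi> z \<le> p z" using Hahn_Banach_sublinear[OF p(1)] by blast
  have "\<bar>\<phi> z\<bar> \<le> norm z" for z
    using \<phi>(2)[of z] p(2)[of z] \<phi>(2)[of "- z"] p(2)[of "- z"] linear_neg[OF \<phi>(1), of z] by simp
  then have bl: "bounded_linear \<phi>"
    using \<phi>(1) by (intro bounded_linear_intro[of _ 1]) (auto simp: linear_add linear_scale)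
  have sep: "\<phi> x + d \<le> \<phi> e" if "e \<in> E" for e
  proof -
    have "\<phi> (- (e - x)) \<le> - d"
      using \<phi>(2)[of "- (e - x)"] p(3)[of "e - x"] that unfolding E'_def by fastforce
    then show ?thesis using linear_diff[OF \<phi>(1), of x e] by simp
  qed
  have "open_halfspace {y. \<phi> y < \<phi> x + d}" using bl unfolding open_halfspace_def by blast
  then show ?thesis using that[of "{y. \<phi> y < \<phi> x + d}"] d sep by fastforce
qed

section \<open>The convexity gap\<close>

definition midpoint_gap :: "('a::real_vector \<Rightarrow> real) \<Rightarrow> 'a \<Rightarrow> 'a \<Rightarrow> real" where
  "midpoint_gap h x y = (h x + h y) / 2 - h (midpoint x y)"

text \<open>
  Uniform convexity of \<open>h\<close> measured by \<open>f\<close> in place of the norm, and only at the scale \<open>r\<close>.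
\<close>
definition gap_controlled_on :: "'a::real_normed_vector set \<Rightarrow> ('a \<Rightarrow> real) \<Rightarrow> real \<Rightarrow> bool" where
  "gap_controlled_on C f r \<longleftrightarrow>
     (\<exists>h \<eta>. convex_on C h \<and> (\<exists>L. L-lipschitz_on C h) \<and> \<eta> > 0 \<and>
       (\<forall>x\<in>C. \<forall>y\<in>C. midpoint_gap h x y < \<eta> \<longrightarrow> \<bar>f x - f y\<bar> \<le> r))"

lemma convex_midpoint_in: "convex C \<Longrightarrow> x \<in> C \<Longrightarrow> y \<in> C \<Longrightarrow> midpoint x y \<in> C"
  unfolding midpoint_def scaleR_add_right by (rule convexD) auto

lemma midpoint_gap_nonneg:
  assumes "convex_on C h" "x \<in> C" "y \<in> C"
  shows "0 \<le> midpoint_gap h x y"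
proof -
  have "h ((1 - 1/2) *\<^sub>R x + (1/2) *\<^sub>R y) \<le> (1 - 1/2) * h x + (1/2) * h y"
    using assms by (intro convex_onD) auto
  then show ?thesis by (simp add: midpoint_gap_def midpoint_def scaleR_add_right)
qed

lemma midpoint_gap_add: "midpoint_gap (\<lambda>x. u x + v x) x y = midpoint_gap u x y + midpoint_gap v x y"
  by (simp add: midpoint_gap_def field_simps)

lemma lipschitz_on_bounded_image:
  fixes u :: "'a::metric_space \<Rightarrow> 'b::metric_space"
  assumes "L-lipschitz_on C u" "bounded C"
  shows "bounded (u ` C)"
proof (cases "C = {}")
  case False
  then obtain a where a: "a \<in> C" by blast
  obtain M where M: "\<forall>x\<in>C. dist a x \<le> M" using assms(2) by (metis bounded_any_center)
  have "dist (u a) (u x) \<le> L * M" if "x \<in> C" for x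
    using lipschitz_onD[OF assms(1) a that] mult_left_mono[OF bspec[OF M that] lipschitz_on_nonneg[OF assms(1)]]
    by simp
  then show ?thesis unfolding bounded_def by blast
qed simp

text \<open>
  In infinite dimensions a bounded set need not be totally bounded, so convexity is used instead:
  every point is reached from a fixed one by a bounded number of short steps along a segment.
\<close>
lemma uniformly_continuous_on_bounded_image:
  fixes f :: "'a::real_normed_vector \<Rightarrow> real"
  assumes "uniformly_continuous_on C f" "bounded C" "convex C"
  shows "bounded (f ` C)"
proof (cases "C = {}")
  case False
  then obtain a where a: "a \<in> C" by blast
  obtain d where d: "d > 0" "\<And>x y. x \<in> C \<Longrightarrow> y \<in> C \<Longrightarrow> dist y x < d \<Longrightarrow> dist (f y) (f x) < 1"
    using assms(1) unfolding uniformly_continuous_on_def by (metis zero_less_one)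
  obtain M where M: "\<And>x. x \<in> C \<Longrightarrow> dist a x \<le> M" using assms(2) by (metis bounded_any_center)
  obtain N :: nat where N: "M / d < real N" using reals_Archimedean2 by blast
  have M0: "M \<ge> 0" using M[OF a] by simp
  have N0: "N > 0" using N M0 d(1) by (metis divide_nonneg_pos leD not_gr_zero of_nat_0)
  have "dist (f a) (f x) \<le> real N" if x: "x \<in> C" for x
  proof -
    define z where "z i = (1 - real i / real N) *\<^sub>R a + (real i / real N) *\<^sub>R x" for i
    have zC: "z i \<in> C" if "i \<le> N" for i
      unfolding z_def using that N0 a x assms(3) by (intro convexD) (auto simp: field_simps)
    have "dist (f a) (f (z i)) \<le> real i" if "i \<le> N" for i
      using that
    proof (induction i)
      case 0
      then show ?case by (simp add: z_def)
    next
      case (Suc i)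
      have "z (Suc i) - z i = (1 / real N) *\<^sub>R (x - a)"
        by (simp add: z_def algebra_simps add_divide_distrib)
      then have "dist (z (Suc i)) (z i) = dist a x / real N"
        by (simp add: dist_norm norm_minus_commute)
      also have "\<dots> \<le> M / real N" using M[OF x] by (simp add: divide_right_mono)
      also have "\<dots> < d" using N N0 d(1) by (simp add: field_simps)
      finally have "dist (f (z (Suc i))) (f (z i)) < 1" using d(2) zC Suc.prems by simp
      then show ?case using Suc dist_triangle2[of "f a" "f (z (Suc i))" "f (z i)"] by simp
    qed
    from this[of N] show ?thesis using N0 by (simp add: z_def)
  qed
  then show ?thesis unfolding bounded_def by blast
qed simp

section \<open>The dentability derivation\<close>

lemma dz_derivation_mono:
  assumes "A \<subseteq> B" "bounded (f ` B)"
  shows "dz_derivation f \<epsilon> A \<subseteq> dz_derivation f \<epsilon> B"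
proof
  fix x assume x: "x \<in> dz_derivation f \<epsilon> A"
  have "diameter (f ` (B \<inter> H)) > \<epsilon>" if "open_halfspace H" "x \<in> H" for H
  proof -
    have "diameter (f ` (A \<inter> H)) \<le> diameter (f ` (B \<inter> H))"
      using assms by (intro diameter_subset bounded_subset[OF assms(2)]) auto
    then show ?thesis using x that unfolding dz_derivation_def by fastforce
  qed
  then show "x \<in> dz_derivation f \<epsilon> B" using x assms(1) unfolding dz_derivation_def by blast
qed

lemma convex_open_halfspace:
  assumes "open_halfspace H"
  shows "convex H" "convex (- H)"
proof -
  obtain \<phi> a where \<phi>: "bounded_linear \<phi>" "H = {x. \<phi> x < (a::real)}"
    using assms unfolding open_halfspace_def by blast
  have "H = \<phi> -` {..<a}" "- H = \<phi> -` {a..}" using \<phi>(2) by auto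
  then show "convex H" "convex (- H)"
    using convex_linear_vimage[OF bounded_linear.linear[OF \<phi>(1)]] by simp_all
qed

text \<open>
  The derivation removes open halfspaces, whose complements are convex.
\<close>
lemma convex_dz_derivation:
  assumes "convex D"
  shows "convex (dz_derivation f \<epsilon> D)"
proof -
  have eq: "dz_derivation f \<epsilon> D = D \<inter> \<Inter> {- H |H. open_halfspace H \<and> diameter (f ` (D \<inter> H)) \<le> \<epsilon>}"
    unfolding dz_derivation_def by (auto simp: not_le[symmetric])
  show ?thesis
    unfolding eq by (intro convex_Int assms convex_Inter) (auto intro: convex_open_halfspace(2))
qed

lemma Dz_finite_iff:
  assumes "C \<noteq> {}"
  shows "Dz_finite C f \<epsilon> \<longleftrightarrow> (\<exists>n. dz_iter f \<epsilon> C n = {})"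
proof
  assume "\<exists>n. dz_iter f \<epsilon> C n = {}"
  then obtain n where n: "dz_iter f \<epsilon> C n = {}" "\<And>m. m < n \<Longrightarrow> dz_iter f \<epsilon> C m \<noteq> {}"
    using exists_least_iff[of "\<lambda>n. dz_iter f \<epsilon> C n = {}"] by blast
  have "n \<noteq> 0" using n(1) assms by (cases n) (auto simp: dz_iter_def)
  then have "Dz_eq C f \<epsilon> n" using n by (simp add: Dz_eq_def)
  then show "Dz_finite C f \<epsilon>" unfolding Dz_finite_def by blast
qed (auto simp: Dz_finite_def Dz_eq_def)

section \<open>Gap control implies finite dentability\<close>

text \<open>
  If \<open>\<bar>h\<bar> \<le> M\<close>, the \<open>n\<close>-th derived set lies in the sublevel set \<open>{h \<le> M - n \<eta>}\<close>, which is empty for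
  large \<open>n\<close>. Comparing with sublevel sets rather than with the derived sets themselves provides the
  closed convex sets that separation requires.
\<close>
theorem gap_controlled_imp_Dz_finite:
  assumes C: "C \<noteq> {}" "bounded C" "closed C" "convex C" and f: "bounded (f ` C)"
    and gc: "gap_controlled_on C f r"
  shows "Dz_finite C f r"
proof -
  obtain h \<eta> L where h: "convex_on C h" "L-lipschitz_on C h" "\<eta> > 0"
    "\<And>x y. x \<in> C \<Longrightarrow> y \<in> C \<Longrightarrow> midpoint_gap h x y < \<eta> \<Longrightarrow> \<bar>f x - f y\<bar> \<le> r"
    using gc unfolding gap_controlled_on_def by blast
  obtain a where a: "a \<in> C" using C(1) by blast
  have r: "r \<ge> 0" using h(4)[OF a a] h(3) by (simp add: midpoint_gap_def)
  obtain M where M: "\<And>x. x \<in> C \<Longrightarrow> \<bar>h x\<bar> \<le> M"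
    using lipschitz_on_bounded_image[OF h(2) C(2)] unfolding bounded_iff by auto
  define E where "E n = {x \<in> C. h x \<le> M - real n * \<eta>}" for n
  have "continuous_on C h" using h(2) by (rule lipschitz_on_continuous_on)
  then have closed_E: "closed (E n)" for n
    using continuous_closed_preimage[OF _ C(3), of h "{..M - real n * \<eta>}"]
    by (simp add: E_def vimage_def Int_def)
  have convex_E: "convex (E n)" for n
    unfolding convex_def
  proof (intro ballI allI impI)
    fix x y and s t :: real assume *: "x \<in> E n" "y \<in> E n" "0 \<le> s" "0 \<le> t" "s + t = 1"
    have "h (s *\<^sub>R x + t *\<^sub>R y) \<le> s * h x + t * h y"
      using h(1) * unfolding convex_on_def E_def by blast
    also have "\<dots> \<le> M - real n * \<eta>" using * by (intro convex_bound_le) (auto simp: E_def)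
    finally show "s *\<^sub>R x + t *\<^sub>R y \<in> E n" using * C(4) by (auto simp: E_def convexD)
  qed
  have step: "dz_derivation f r (E n) \<subseteq> E (Suc n)" for n
  proof (rule ccontr)
    assume "\<not> ?thesis"
    then obtain x where x: "x \<in> dz_derivation f r (E n)" "x \<notin> E (Suc n)" by blast
    obtain H where H: "open_halfspace H" "x \<in> H" "H \<inter> E (Suc n) = {}"
      using open_halfspace_separates_point[OF closed_E convex_E x(2)] .
    have "\<bar>f y - f z\<bar> \<le> r" if "y \<in> E n \<inter> H" "z \<in> E n \<inter> H" for y z
    proof (rule h(4))
      have "midpoint y z \<in> E n \<inter> H" using that convex_midpoint_in[of "E n \<inter> H"] convex_E convex_open_halfspace(1)[OF H(1)]
        by (simp add: convex_Int)
      then have "h (midpoint y z) > M - real (Suc n) * \<eta>" using H(3) unfolding E_def by fastforce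
      then show "midpoint_gap h y z < \<eta>"
        using that by (simp add: midpoint_gap_def E_def algebra_simps)
    qed (use that in \<open>auto simp: E_def\<close>)
    then have "diameter (f ` (E n \<inter> H)) \<le> r" using r by (intro diameter_le) auto
    then show False using x(1) H unfolding dz_derivation_def by fastforce
  qed
  have "dz_iter f r C n \<subseteq> E n" for n
  proof (induction n)
    case 0
    then show ?case using M by (auto simp: dz_iter_def E_def abs_le_iff)
  next
    case (Suc n)
    have "dz_derivation f r (dz_iter f r C n) \<subseteq> dz_derivation f r (E n)"
      by (rule dz_derivation_mono[OF Suc]) (rule bounded_subset[OF f], auto simp: E_def)
    then show ?case using step by (force simp: dz_iter_def)
  qed
  moreover obtain n :: nat where "2 * M / \<eta> < real n" using reals_Archimedean2 by blast
  then have "M - real n * \<eta> < - M" using h(3) by (simp add: field_simps)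
  then have "E n = {}" using M unfolding E_def by (fastforce simp: abs_le_iff)
  ultimately show ?thesis using Dz_finite_iff[OF C(1)] by (metis subset_empty)
qed

section \<open>Functions near a DC-Lipschitz function are gap-controlled\<close>

lemma convex_on_power2:
  fixes u :: "'a::real_vector \<Rightarrow> real"
  assumes u: "convex_on C u" "\<And>x. x \<in> C \<Longrightarrow> 0 \<le> u x"
  shows "convex_on C (\<lambda>x. (u x)\<^sup>2)"
  unfolding convex_on_def
proof (intro conjI ballI allI impI)
  show C: "convex C" using u(1) by (rule convex_on_imp_convex)
  fix x y and s t :: real assume *: "x \<in> C" "y \<in> C" "0 \<le> s" "0 \<le> t" "s + t = 1"
  then have s: "s = 1 - t" by simp
  have "s *\<^sub>R x + t *\<^sub>R y \<in> C" using * C by (simp add: convexD)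
  then have "(u (s *\<^sub>R x + t *\<^sub>R y))\<^sup>2 \<le> (s * u x + t * u y)\<^sup>2"
    using u * unfolding convex_on_def by (intro power_mono) auto
  also have "\<dots> \<le> s * (u x)\<^sup>2 + t * (u y)\<^sup>2"
    using convex_onD[OF convex_power2, of t "u x" "u y"] * unfolding s by simp
  finally show "(u (s *\<^sub>R x + t *\<^sub>R y))\<^sup>2 \<le> s * (u x)\<^sup>2 + t * (u y)\<^sup>2" .
qed

lemma lipschitz_on_power2:
  fixes u :: "'a::metric_space \<Rightarrow> real"
  assumes u: "L-lipschitz_on C u" and C: "bounded C"
  shows "\<exists>K. K-lipschitz_on C (\<lambda>x. (u x)\<^sup>2)"
proof -
  obtain M where M: "\<And>x. x \<in> C \<Longrightarrow> \<bar>u x\<bar> \<le> M"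
    using lipschitz_on_bounded_image[OF u C] unfolding bounded_iff by auto
  have "(2 * \<bar>M\<bar> * L)-lipschitz_on C (\<lambda>x. (u x)\<^sup>2)"
  proof (rule lipschitz_onI)
    fix x y assume xy: "x \<in> C" "y \<in> C"
    have "dist ((u x)\<^sup>2) ((u y)\<^sup>2) = \<bar>u x + u y\<bar> * \<bar>u x - u y\<bar>"
      by (simp add: dist_real_def power2_eq_square abs_mult[symmetric] algebra_simps)
    also have "\<dots> \<le> (2 * \<bar>M\<bar>) * (L * dist x y)"
      using M[OF xy(1)] M[OF xy(2)] lipschitz_onD[OF u xy]
      by (intro mult_mono) (auto simp: dist_real_def)
    finally show "dist ((u x)\<^sup>2) ((u y)\<^sup>2) \<le> 2 * \<bar>M\<bar> * L * dist x y" by (simp add: mult.assoc)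
  qed (use lipschitz_on_nonneg[OF u] in simp)
  then show ?thesis by blast
qed

text \<open>
  Squaring turns a merely convex nonnegative function into one whose gap detects its own increments: the
  parallelogram identity for \<open>u x\<close> and \<open>u y\<close>, with \<open>u (midpoint x y)\<close> at most their mean.
\<close>
lemma midpoint_gap_power2:
  fixes u :: "'a::real_vector \<Rightarrow> real"
  assumes u: "convex_on C u" "\<And>x. x \<in> C \<Longrightarrow> 0 \<le> u x" and xy: "x \<in> C" "y \<in> C"
  shows "(u x - u y)\<^sup>2 / 4 \<le> midpoint_gap (\<lambda>x. (u x)\<^sup>2) x y"
proof -
  have "0 \<le> midpoint_gap u x y" by (rule midpoint_gap_nonneg[OF u(1) xy])
  then have "(u (midpoint x y))\<^sup>2 \<le> ((u x + u y) / 2)\<^sup>2"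
    using u(2) convex_midpoint_in[OF convex_on_imp_convex[OF u(1)] xy]
    by (intro power_mono) (auto simp: midpoint_gap_def)
  then show ?thesis by (simp add: midpoint_gap_def power2_eq_square field_simps)
qed

theorem DC_near_imp_gap_controlled:
  assumes C: "C \<noteq> {}" "bounded C" and g: "DC_Lipschitz_on C g"
    and near: "\<And>x. x \<in> C \<Longrightarrow> \<bar>f x - g x\<bar> \<le> s" and s: "s < \<epsilon>"
  shows "gap_controlled_on C f (2 * \<epsilon>)"
proof -
  obtain u v K L where u: "convex_on C u" "K-lipschitz_on C u" and v: "convex_on C v" "L-lipschitz_on C v"
    and guv: "\<And>x. x \<in> C \<Longrightarrow> g x = u x - v x"
    using g unfolding DC_Lipschitz_on_def by blast
  obtain M where M: "\<And>x. x \<in> C \<Longrightarrow> \<bar>u x\<bar> \<le> M"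
    using lipschitz_on_bounded_image[OF u(2) C(2)] unfolding bounded_iff by auto
  obtain N where N: "\<And>x. x \<in> C \<Longrightarrow> \<bar>v x\<bar> \<le> N"
    using lipschitz_on_bounded_image[OF v(2) C(2)] unfolding bounded_iff by auto
  have cC: "convex C" using u(1) by (rule convex_on_imp_convex)
  define u' where "u' x = u x + M" for x
  define v' where "v' x = v x + N" for x
  have u': "convex_on C u'" "\<And>x. x \<in> C \<Longrightarrow> 0 \<le> u' x" "(K + 0)-lipschitz_on C u'"
    and v': "convex_on C v'" "\<And>x. x \<in> C \<Longrightarrow> 0 \<le> v' x" "(L + 0)-lipschitz_on C v'"
    using u v M N cC unfolding u'_def v'_def
    by (force intro!: convex_on_add lipschitz_on_add lipschitz_on_constant simp: convex_on_const abs_le_iff)+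
  define h where "h x = (u' x)\<^sup>2 + (v' x)\<^sup>2" for x
  \<comment> \<open>Replacing \<open>f\<close> by \<open>g\<close> at both points costs \<open>2 * s\<close>, so \<open>g\<close> may vary by \<open>\<delta>\<close>.\<close>
  define \<delta> where "\<delta> = 2 * (\<epsilon> - s)"
  have \<delta>: "\<delta> > 0" using s by (simp add: \<delta>_def)
  have "convex_on C h" unfolding h_def by (intro convex_on_add convex_on_power2 u' v')
  moreover have "\<exists>L. L-lipschitz_on C h"
    using lipschitz_on_power2[OF u'(3) C(2)] lipschitz_on_power2[OF v'(3) C(2)] lipschitz_on_add
    unfolding h_def by blast
  moreover have "\<delta>\<^sup>2 / 8 > 0" using \<delta> by simp
  moreover have "\<bar>f x - f y\<bar> \<le> 2 * \<epsilon>" if xy: "x \<in> C" "y \<in> C" "midpoint_gap h x y < \<delta>\<^sup>2 / 8" for x y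
  proof -
    have "(u' x - u' y)\<^sup>2 / 4 + (v' x - v' y)\<^sup>2 / 4 \<le> midpoint_gap h x y"
      using midpoint_gap_power2[OF u'(1,2) xy(1,2)] midpoint_gap_power2[OF v'(1,2) xy(1,2)]
      unfolding h_def midpoint_gap_add by simp
    moreover have "(g x - g y)\<^sup>2 \<le> 2 * (u' x - u' y)\<^sup>2 + 2 * (v' x - v' y)\<^sup>2"
    proof -
      have "(a - b)\<^sup>2 \<le> 2 * a\<^sup>2 + 2 * b\<^sup>2" for a b :: real
        using zero_le_power2[of "a + b"] by (simp add: power2_eq_square algebra_simps)
      moreover have "g x - g y = (u' x - u' y) - (v' x - v' y)"
        using guv xy by (simp add: u'_def v'_def)
      ultimately show ?thesis by simp
    qed
    ultimately have "(g x - g y)\<^sup>2 \<le> \<delta>\<^sup>2" using xy(3) by simp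
    then have "\<bar>g x - g y\<bar> \<le> \<delta>" using \<delta> by (simp add: abs_le_square_iff[symmetric])
    then show ?thesis using near[OF xy(1)] near[OF xy(2)] by (simp add: \<delta>_def abs_le_iff)
  qed
  ultimately show ?thesis unfolding gap_controlled_on_def by blast
qed

section \<open>Finite dentability implies gap control\<close>

lemma midpoint_gap_commute: "midpoint_gap h x y = midpoint_gap h y x"
  by (simp add: midpoint_gap_def midpoint_sym add.commute)

text \<open>
  The gap at the midpoint bounds the deviation from the chord everywhere on the segment: the
  midpoint lies between \<open>p\<close> and the endpoint farther from \<open>p\<close>, so a low value at \<open>p\<close> would pull
  down the value at the midpoint.
\<close>
lemma midpoint_gap_bounds_segment:
  assumes u: "convex_on C u" and xy: "x \<in> C" "y \<in> C" and t: "0 \<le> t" "t \<le> 1"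
  shows "(1 - t) * u x + t * u y - 2 * midpoint_gap u x y \<le> u ((1 - t) *\<^sub>R x + t *\<^sub>R y)"
proof -
  have *: "(1 - t) * u x + t * u y - 2 * midpoint_gap u x y \<le> u ((1 - t) *\<^sub>R x + t *\<^sub>R y)"
    if xy: "x \<in> C" "y \<in> C" and t: "1/2 \<le> t" "t \<le> 1" for x y t
  proof -
    let ?p = "(1 - t) *\<^sub>R x + t *\<^sub>R y"
    let ?s = "1 / (2 * t)"
    have p: "?p \<in> C" using convex_on_imp_convex[OF u] xy t by (intro convexD) auto
    have st: "?s * (1 - t) = ?s - 1/2" "?s * t = 1/2" using t by (auto simp: field_simps)
    have "(1 - ?s) *\<^sub>R x + ?s *\<^sub>R ?p = (1 - ?s + ?s * (1 - t)) *\<^sub>R x + (?s * t) *\<^sub>R y"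
      by (simp add: scaleR_add_right scaleR_add_left)
    also have "\<dots> = midpoint x y" unfolding st by (simp add: midpoint_def scaleR_add_right)
    finally have m: "midpoint x y = (1 - ?s) *\<^sub>R x + ?s *\<^sub>R ?p" by simp
    have "u (midpoint x y) \<le> (1 - ?s) * u x + ?s * u ?p"
      unfolding m using t by (intro convex_onD[OF u]) (use xy p in auto)
    then have "2 * t * u (midpoint x y) \<le> 2 * t * ((1 - ?s) * u x + ?s * u ?p)"
      using t by (intro mult_left_mono) auto
    also have "\<dots> = (2 * t - 1) * u x + u ?p" using t by (simp add: field_simps)
    finally have "2 * t * u (midpoint x y) \<le> (2 * t - 1) * u x + u ?p" .
    moreover have "2 * t * midpoint_gap u x y = t * u x + t * u y - 2 * t * u (midpoint x y)"
      by (simp add: midpoint_gap_def field_simps)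
    ultimately have "(1 - t) * u x + t * u y - 2 * t * midpoint_gap u x y \<le> u ?p"
      by (simp add: algebra_simps)
    moreover have "2 * t * midpoint_gap u x y \<le> 2 * midpoint_gap u x y"
      using midpoint_gap_nonneg[OF u xy] t mult_right_mono[of "2 * t" 2] by simp
    ultimately show ?thesis by simp
  qed
  show ?thesis
  proof (cases "1/2 \<le> t")
    case True
    then show ?thesis using * xy t by blast
  next
    case False
    then show ?thesis
      using *[OF xy(2,1), of "1 - t"] t by (simp add: midpoint_gap_commute[of u y x] add.commute)
  qed
qed

lemma infdist_approx:
  assumes "A \<noteq> {}" "0 < e"
  obtains a where "a \<in> A" "dist x a < infdist x A + e"
  using cInf_lessD[of "dist x ` A" "infdist x A + e"] assms
  by (auto simp: infdist_notempty)

lemma dist_convex_combination_le: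
  fixes x y a b :: "'a::real_normed_vector"
  assumes "0 \<le> s" "0 \<le> t"
  shows "dist (s *\<^sub>R x + t *\<^sub>R y) (s *\<^sub>R a + t *\<^sub>R b) \<le> s * dist x a + t * dist y b"
proof -
  have "(s *\<^sub>R x + t *\<^sub>R y) - (s *\<^sub>R a + t *\<^sub>R b) = s *\<^sub>R (x - a) + t *\<^sub>R (y - b)"
    by (simp add: algebra_simps)
  then show ?thesis
    using norm_triangle_ineq[of "s *\<^sub>R (x - a)" "t *\<^sub>R (y - b)"] assms by (simp add: dist_norm)
qed

lemma convex_on_infdist:
  fixes A :: "'a::real_normed_vector set"
  assumes A: "convex A" "A \<noteq> {}" and C: "convex C"
  shows "convex_on C (\<lambda>x. infdist x A)"
  unfolding convex_on_def
proof (intro conjI ballI allI impI)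
  fix x y and s t :: real assume *: "x \<in> C" "y \<in> C" "0 \<le> s" "0 \<le> t" "s + t = 1"
  show "infdist (s *\<^sub>R x + t *\<^sub>R y) A \<le> s * infdist x A + t * infdist y A"
  proof (rule field_le_epsilon)
    fix e :: real assume e: "0 < e"
    obtain a where a: "a \<in> A" "dist x a < infdist x A + e" using infdist_approx[OF A(2) e] .
    obtain b where b: "b \<in> A" "dist y b < infdist y A + e" using infdist_approx[OF A(2) e] .
    have "s *\<^sub>R a + t *\<^sub>R b \<in> A" using A(1) a b * by (simp add: convexD)
    then have "infdist (s *\<^sub>R x + t *\<^sub>R y) A \<le> dist (s *\<^sub>R x + t *\<^sub>R y) (s *\<^sub>R a + t *\<^sub>R b)"
      by (rule infdist_le)
    also have "\<dots> \<le> s * dist x a + t * dist y b"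
      using * by (intro dist_convex_combination_le) auto
    also have "\<dots> \<le> s * (infdist x A + e) + t * (infdist y A + e)"
      using a b * by (intro add_mono mult_left_mono) auto
    also have "\<dots> = s * infdist x A + t * infdist y A + (s + t) * e" by (simp add: algebra_simps)
    finally show "infdist (s *\<^sub>R x + t *\<^sub>R y) A \<le> s * infdist x A + t * infdist y A + e"
      using * by simp
  qed
qed (rule C)

lemma lipschitz_on_infdist: "1-lipschitz_on C (\<lambda>x. infdist x A)"
  by (rule lipschitz_onI) (auto simp: dist_real_def infdist_triangle_abs)

text \<open>
  A slice that contains a point of the segment contains one of its endpoints, so each point of the
  segment is \<open>\<epsilon>\<close>-close in value to \<open>x\<close> or to \<open>y\<close>. Both alternatives are closed conditions, each
  satisfied at one endpoint; since the segment is connected, they hold together at some point.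
\<close>
lemma oscillation_on_segment:
  fixes f :: "'a::real_normed_vector \<Rightarrow> real"
  assumes D: "convex D" and f: "continuous_on D f" "bounded (f ` D)" and \<epsilon>: "0 \<le> \<epsilon>"
    and xy: "x \<in> D" "y \<in> D"
    and seg: "\<And>t. 0 \<le> t \<Longrightarrow> t \<le> 1 \<Longrightarrow> (1 - t) *\<^sub>R x + t *\<^sub>R y \<notin> dz_derivation f \<epsilon> D"
  shows "\<bar>f x - f y\<bar> \<le> 2 * \<epsilon>"
proof -
  define p where "p t = (1 - t) *\<^sub>R x + t *\<^sub>R y" for t :: real
  have pD: "p t \<in> D" if "t \<in> {0..1}" for t
    unfolding p_def using that D xy by (intro convexD) auto
  have cont: "continuous_on {0..1} (\<lambda>t. f (p t))"
    by (rule continuous_on_compose2[OF f(1)]) (use pD in \<open>auto simp: p_def intro!: continuous_intros\<close>)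
  define A where "A z = {0..1} \<inter> (\<lambda>t. f (p t)) -` {z - \<epsilon>..z + \<epsilon>}" for z
  have closed_A: "closed (A z)" for z
    unfolding A_def by (rule continuous_closed_preimage[OF cont]) auto
  have "t \<in> A (f x) \<union> A (f y)" if t: "t \<in> {0..1}" for t
  proof -
    have "p t \<in> D" "p t \<notin> dz_derivation f \<epsilon> D" using pD[OF t] seg t unfolding p_def by auto
    then obtain H where H: "open_halfspace H" "p t \<in> H" "diameter (f ` (D \<inter> H)) \<le> \<epsilon>"
      unfolding dz_derivation_def by (auto simp: not_less)
    have osc: "\<bar>f (p t) - f z\<bar> \<le> \<epsilon>" if "z \<in> D" "z \<in> H" for z
    proof -
      have "dist (f (p t)) (f z) \<le> diameter (f ` (D \<inter> H))"
        using that H(2) pD[OF t] by (intro diameter_bounded_bound bounded_subset[OF f(2)]) auto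
      then show ?thesis using H(3) by (simp add: dist_real_def)
    qed
    have "x \<in> H \<or> y \<in> H"
    proof (rule ccontr)
      assume "\<not> ?thesis"
      then have "(1 - t) *\<^sub>R x + t *\<^sub>R y \<in> - H"
        using t by (intro convexD[OF convex_open_halfspace(2)[OF H(1)]]) auto
      then show False using H(2) unfolding p_def by simp
    qed
    then show ?thesis using osc xy t by (fastforce simp: A_def abs_le_iff)
  qed
  moreover have "0 \<in> A (f x)" "1 \<in> A (f y)" using \<epsilon> by (auto simp: A_def p_def)
  moreover have "A z \<subseteq> {0..1}" for z by (auto simp: A_def)
  ultimately have "A (f x) \<inter> A (f y) \<inter> {0..1} \<noteq> {}"
    using connected_closedD[of "{0..1::real}" "A (f x)" "A (f y)"] closed_A by fastforce
  then show ?thesis by (auto simp: A_def abs_le_iff)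
qed

text \<open>
  Induction on the number of derivations that exhaust \<open>D\<close>, for points near \<open>D\<close> rather than in \<open>D\<close>,
  because a small distance to \<open>D'\<close> is all that the step can provide. Let \<open>u\<close> be the distance to \<open>D'\<close>. If both
  points are near \<open>D'\<close>, the induction hypothesis applies. Otherwise the gap of \<open>u\<^sup>2\<close> makes \<open>u x\<close> and
  \<open>u y\<close> almost equal, hence both large, and the gap of \<open>u\<close> keeps the whole segment away from \<open>D'\<close>.
  Moving the endpoints into \<open>D\<close> gives a segment in \<open>D - D'\<close>.
\<close>
lemma gap_controls_near_derivation_layers:
  fixes f :: "'a::real_normed_vector \<Rightarrow> real"
  assumes C: "convex C" "bounded C" and f: "uniformly_continuous_on C f"
    and \<epsilon>: "0 \<le> \<epsilon>" and \<delta>: "0 < \<delta>"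
  shows "D \<subseteq> C \<Longrightarrow> convex D \<Longrightarrow> D \<noteq> {} \<Longrightarrow> dz_iter f \<epsilon> D n = {} \<Longrightarrow>
    \<exists>h \<eta>. convex_on C h \<and> (\<exists>L. L-lipschitz_on C h) \<and> 0 < \<eta> \<and>
      (\<forall>x\<in>C. \<forall>y\<in>C. infdist x D \<le> \<eta> \<longrightarrow> infdist y D \<le> \<eta> \<longrightarrow> midpoint_gap h x y < \<eta> \<longrightarrow>
        \<bar>f x - f y\<bar> \<le> 2 * \<epsilon> + \<delta>)"
proof (induction n arbitrary: D)
  case 0
  then show ?case by (simp add: dz_iter_def)
next
  case (Suc n)
  note D = Suc.prems(1-3)
  define D' where "D' = dz_derivation f \<epsilon> D"
  have bf: "bounded (f ` D)"
    using uniformly_continuous_on_bounded_image[OF f C(2,1)] D(1) by (blast intro: bounded_subset)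
  have cf: "continuous_on D f"
    using uniformly_continuous_imp_continuous[OF f] D(1) by (rule continuous_on_subset)
  obtain d where d: "d > 0" "\<And>x y. x \<in> C \<Longrightarrow> y \<in> C \<Longrightarrow> dist x y < d \<Longrightarrow> \<bar>f x - f y\<bar> < \<delta> / 2"
    using f \<delta> half_gt_zero[OF \<delta>] unfolding uniformly_continuous_on_def dist_real_def by metis
  \<comment> \<open>The case in which the segment stays away from \<open>D'\<close>.\<close>
  have transfer: "\<bar>f x - f y\<bar> \<le> 2 * \<epsilon> + \<delta>"
    if xy: "x \<in> C" "y \<in> C" "infdist x D \<le> \<eta>" "infdist y D \<le> \<eta>" and \<eta>: "0 < \<eta>" "2 * \<eta> \<le> d"
      and off: "\<And>t q. 0 \<le> t \<Longrightarrow> t \<le> 1 \<Longrightarrow> dist ((1 - t) *\<^sub>R x + t *\<^sub>R y) q \<le> 2 * \<eta> \<Longrightarrow> q \<notin> D'"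
    for x y \<eta>
  proof -
    obtain x' where x': "x' \<in> D" "dist x x' < infdist x D + \<eta>" using infdist_approx[OF D(3) \<eta>(1)] .
    obtain y' where y': "y' \<in> D" "dist y y' < infdist y D + \<eta>" using infdist_approx[OF D(3) \<eta>(1)] .
    have dx: "dist x x' < 2 * \<eta>" and dy: "dist y y' < 2 * \<eta>" using x' y' xy by auto
    have "\<bar>f x' - f y'\<bar> \<le> 2 * \<epsilon>"
    proof (rule oscillation_on_segment[OF D(2) cf bf \<epsilon> x'(1) y'(1)])
      fix t :: real assume t: "0 \<le> t" "t \<le> 1"
      have "dist ((1 - t) *\<^sub>R x + t *\<^sub>R y) ((1 - t) *\<^sub>R x' + t *\<^sub>R y') \<le> (1 - t) * dist x x' + t * dist y y'"
        using t by (intro dist_convex_combination_le) auto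
      also have "\<dots> \<le> 2 * \<eta>" using t dx dy by (intro convex_bound_le) auto
      finally show "(1 - t) *\<^sub>R x' + t *\<^sub>R y' \<notin> dz_derivation f \<epsilon> D"
        using off[OF t] unfolding D'_def by blast
    qed
    moreover have "\<bar>f x - f x'\<bar> < \<delta> / 2" "\<bar>f y - f y'\<bar> < \<delta> / 2"
      using d(2) xy x' y' dx dy \<eta> D(1) by (auto intro!: d(2))
    ultimately show ?thesis by linarith
  qed
  show ?case
  proof (cases "D' = {}")
    case True
    have "convex_on C (\<lambda>x. 0)" "0-lipschitz_on C (\<lambda>x. 0::real)"
      using C(1) by (auto simp: convex_on_const intro: lipschitz_intros)
    moreover have "0 < d / 2" using d(1) by simp
    moreover have "\<bar>f x - f y\<bar> \<le> 2 * \<epsilon> + \<delta>"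
      if "x \<in> C" "y \<in> C" "infdist x D \<le> d / 2" "infdist y D \<le> d / 2" for x y
      using transfer[OF that] d(1) True by auto
    ultimately show ?thesis by blast
  next
    case False
    have D': "D' \<subseteq> C" "convex D'" "D' \<noteq> {}" "dz_iter f \<epsilon> D' n = {}"
      using D convex_dz_derivation[OF D(2)] False Suc.prems(4)
      by (auto simp: D'_def dz_derivation_def dz_iter_def funpow_swap1)
    obtain h' \<eta>' L' where h': "convex_on C h'" "L'-lipschitz_on C h'" "0 < \<eta>'"
      "\<And>x y. x \<in> C \<Longrightarrow> y \<in> C \<Longrightarrow> infdist x D' \<le> \<eta>' \<Longrightarrow> infdist y D' \<le> \<eta>' \<Longrightarrow>
        midpoint_gap h' x y < \<eta>' \<Longrightarrow> \<bar>f x - f y\<bar> \<le> 2 * \<epsilon> + \<delta>"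
      using Suc.IH[OF D'] by blast
    define u where "u x = infdist x D'" for x
    have u: "convex_on C u" "\<And>x. 0 \<le> u x" "1-lipschitz_on C u"
      unfolding u_def using convex_on_infdist[OF D'(2,3) C(1)] infdist_nonneg lipschitz_on_infdist by auto
    define h where "h x = h' x + ((u x)\<^sup>2 + u x)" for x
    have "convex_on C h"
      unfolding h_def using h'(1) u by (intro convex_on_add convex_on_power2) auto
    moreover have "\<exists>L. L-lipschitz_on C h"
      using lipschitz_on_power2[OF u(3) C(2)] u(3) h'(2) lipschitz_on_add unfolding h_def by blast
    moreover
    \<comment> \<open>The square makes a gap below \<open>\<eta>\<close> bound \<open>\<bar>u x - u y\<bar>\<close> by \<open>\<eta>' / 4\<close>. That bound, the loss
      \<open>2 * \<eta>\<close> along the segment and the displacement \<open>2 * \<eta>\<close> together stay below \<open>\<eta>'\<close>.\<close>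
    define \<eta> where "\<eta> = min (min (d / 2) (\<eta>' / 8)) ((\<eta>' / 8)\<^sup>2)"
    have \<eta>: "0 < \<eta>" "2 * \<eta> \<le> d" "\<eta> \<le> \<eta>' / 8" "\<eta> \<le> (\<eta>' / 8)\<^sup>2"
      using d(1) h'(3) by (auto simp: \<eta>_def min_def)
    moreover have "\<bar>f x - f y\<bar> \<le> 2 * \<epsilon> + \<delta>"
      if xy: "x \<in> C" "y \<in> C" "infdist x D \<le> \<eta>" "infdist y D \<le> \<eta>" and gap: "midpoint_gap h x y < \<eta>" for x y
    proof -
      have "midpoint_gap h x y
          = midpoint_gap h' x y + (midpoint_gap (\<lambda>x. (u x)\<^sup>2) x y + midpoint_gap u x y)"
        unfolding h_def midpoint_gap_add ..
      moreover have "0 \<le> midpoint_gap h' x y" "0 \<le> midpoint_gap u x y"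
        using midpoint_gap_nonneg[OF _ xy(1,2)] h'(1) u(1) by auto
      moreover have sq: "(u x - u y)\<^sup>2 / 4 \<le> midpoint_gap (\<lambda>x. (u x)\<^sup>2) x y"
        using midpoint_gap_power2[OF u(1) _ xy(1,2)] u(2) by blast
      moreover have "0 \<le> (u x - u y)\<^sup>2" by simp
      ultimately have gaps: "midpoint_gap h' x y < \<eta>" "midpoint_gap u x y < \<eta>" "(u x - u y)\<^sup>2 < 4 * \<eta>"
        using gap by linarith+
      show ?thesis
      proof (cases "u x \<le> \<eta>' \<and> u y \<le> \<eta>'")
        case True
        then show ?thesis using h'(4)[OF xy(1,2)] gaps(1) \<eta>(3) h'(3) unfolding u_def by simp
      next
        case far: False
        have "(u x - u y)\<^sup>2 < (\<eta>' / 4)\<^sup>2"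
          using gaps(3) \<eta>(4) by (simp add: power_divide)
        then have close: "\<bar>u x - u y\<bar> < \<eta>' / 4"
          using h'(3) by (intro power2_less_imp_less[of "\<bar>u x - u y\<bar>"]) auto
        show ?thesis
        proof (rule transfer[OF xy \<eta>(1,2)])
          fix t :: real and q assume t: "0 \<le> t" "t \<le> 1"
          let ?p = "(1 - t) *\<^sub>R x + t *\<^sub>R y"
          assume q: "dist ?p q \<le> 2 * \<eta>"
          have "3/4 * \<eta>' \<le> u x" "3/4 * \<eta>' \<le> u y" using far close by linarith+
          then have "3/4 * \<eta>' \<le> (1 - t) * u x + t * u y"
            using convex_bound_le[of "- u x" "- (3/4 * \<eta>')" "- u y" "1 - t" t] t by simp
          also have "\<dots> < u ?p + 2 * \<eta>"
            using midpoint_gap_bounds_segment[OF u(1) xy(1,2) t] gaps(2) by linarith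
          also have "u ?p \<le> u q + dist ?p q" unfolding u_def by (rule infdist_triangle)
          finally have "0 < u q" using q \<eta>(3) h'(3) by linarith
          then show "q \<notin> D'" unfolding u_def using infdist_zero[of q D'] by auto
        qed
      qed
    qed
    ultimately show ?thesis by blast
  qed
qed

theorem Dz_finite_imp_gap_controlled:
  fixes f :: "'a::real_normed_vector \<Rightarrow> real"
  assumes C: "C \<noteq> {}" "convex C" "bounded C" and f: "uniformly_continuous_on C f"
    and \<epsilon>: "0 \<le> \<epsilon>" "Dz_finite C f \<epsilon>" and \<delta>: "0 < \<delta>"
  shows "gap_controlled_on C f (2 * \<epsilon> + \<delta>)"
proof -
  obtain n where "dz_iter f \<epsilon> C n = {}" using \<epsilon>(2) Dz_finite_iff[OF C(1)] by blast
  then obtain h \<eta> where h: "convex_on C h" "\<exists>L. L-lipschitz_on C h" "0 < \<eta>"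
    "\<forall>x\<in>C. \<forall>y\<in>C. infdist x C \<le> \<eta> \<longrightarrow> infdist y C \<le> \<eta> \<longrightarrow> midpoint_gap h x y < \<eta> \<longrightarrow>
        \<bar>f x - f y\<bar> \<le> 2 * \<epsilon> + \<delta>"
    using gap_controls_near_derivation_layers[OF C(2,3) f \<epsilon>(1) \<delta> subset_refl C(2,1)] by blast
  then show ?thesis unfolding gap_controlled_on_def
    by (intro exI[of _ h] exI[of _ \<eta>]) auto
qed

section \<open>Gap control implies DC-Lipschitz approximation\<close>

lemma convex_lipschitz_on_SUP:
  fixes w :: "'i \<Rightarrow> 'a::real_normed_vector \<Rightarrow> real"
  assumes I: "I \<noteq> {}" and w: "\<And>i. i \<in> I \<Longrightarrow> convex_on C (w i)" "\<And>i. i \<in> I \<Longrightarrow> L-lipschitz_on C (w i)"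
    and bdd: "\<And>x. x \<in> C \<Longrightarrow> bdd_above ((\<lambda>i. w i x) ` I)"
  shows "convex_on C (\<lambda>x. SUP i\<in>I. w i x)" "L-lipschitz_on C (\<lambda>x. SUP i\<in>I. w i x)"
proof -
  define v where "v x = (SUP i\<in>I. w i x)" for x
  have upper: "w i x \<le> v x" if "i \<in> I" "x \<in> C" for i x
    unfolding v_def using that bdd by (intro cSUP_upper) auto
  have least: "v x \<le> b" if "\<And>i. i \<in> I \<Longrightarrow> w i x \<le> b" for x b
    unfolding v_def using I that by (intro cSUP_least) auto
  obtain i0 where i0: "i0 \<in> I" using I by blast
  show "convex_on C (\<lambda>x. SUP i\<in>I. w i x)"
    unfolding v_def[symmetric] convex_on_def
  proof (intro conjI ballI allI impI least)
    show "convex C" using convex_on_imp_convex[OF w(1)[OF i0]] .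
    fix x y and s t :: real and i assume *: "x \<in> C" "y \<in> C" "0 \<le> s" "0 \<le> t" "s + t = 1" "i \<in> I"
    have "w i (s *\<^sub>R x + t *\<^sub>R y) \<le> s * w i x + t * w i y"
      using w(1) * unfolding convex_on_def by blast
    also have "\<dots> \<le> s * v x + t * v y" using * upper by (intro add_mono mult_left_mono) auto
    finally show "w i (s *\<^sub>R x + t *\<^sub>R y) \<le> s * v x + t * v y" .
  qed
  show "L-lipschitz_on C (\<lambda>x. SUP i\<in>I. w i x)"
    unfolding v_def[symmetric]
  proof (rule lipschitz_onI)
    have *: "v x \<le> v y + L * dist x y" if xy: "x \<in> C" "y \<in> C" for x y
    proof (rule least)
      fix i assume i: "i \<in> I"
      show "w i x \<le> v y + L * dist x y"
        using lipschitz_onD[OF w(2)[OF i] xy] upper[OF i xy(2)] by (simp add: dist_real_def abs_le_iff)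
    qed
    show "dist (v x) (v y) \<le> L * dist x y" if "x \<in> C" "y \<in> C" for x y
      using *[OF that] *[OF that(2,1)] by (simp add: dist_real_def abs_le_iff dist_commute)
    show "0 \<le> L" by (rule lipschitz_on_nonneg[OF w(2)[OF i0]])
  qed
qed

text \<open>
  The approximation is \<open>g x = inf\<^sub>y (f y + k gap(x, y))\<close>. The choice \<open>y = x\<close> shows \<open>g \<le> f\<close>. Conversely, a
  \<open>y\<close> of gap below \<open>\<eta>\<close> has \<open>f y \<ge> f x - r\<close>, and for any other \<open>y\<close> the penalty is at least the
  total oscillation of \<open>f\<close>.
\<close>
theorem gap_controlled_imp_DC_near:
  fixes f :: "'a::real_normed_vector \<Rightarrow> real"
  assumes C: "C \<noteq> {}" "bounded C" and f: "bounded (f ` C)" and gc: "gap_controlled_on C f r"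
  obtains g where "DC_Lipschitz_on C g" "\<And>x. x \<in> C \<Longrightarrow> \<bar>f x - g x\<bar> \<le> r"
proof -
  obtain h \<eta> L where h: "convex_on C h" "L-lipschitz_on C h" "\<eta> > 0"
    "\<And>x y. x \<in> C \<Longrightarrow> y \<in> C \<Longrightarrow> midpoint_gap h x y < \<eta> \<Longrightarrow> \<bar>f x - f y\<bar> \<le> r"
    using gc unfolding gap_controlled_on_def by blast
  have cC: "convex C" using h(1) by (rule convex_on_imp_convex)
  obtain a where a: "a \<in> C" using C(1) by blast
  have r: "r \<ge> 0" using h(4)[OF a a] h(3) by (simp add: midpoint_gap_def)
  obtain F where F: "\<And>x. x \<in> C \<Longrightarrow> \<bar>f x\<bar> \<le> F" using f unfolding bounded_iff by auto
  have F0: "F \<ge> 0" using F[OF a] by simp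
  obtain M where M: "\<And>x. x \<in> C \<Longrightarrow> \<bar>h x\<bar> \<le> M"
    using lipschitz_on_bounded_image[OF h(2) C(2)] unfolding bounded_iff by auto
  \<comment> \<open>A gap of at least \<open>\<eta>\<close> then costs at least \<open>2 * F\<close>, which bounds the oscillation of \<open>f\<close>.\<close>
  define k where "k = 2 * F / \<eta>"
  have k: "k \<ge> 0" "k * \<eta> = 2 * F" using F0 h(3) by (auto simp: k_def)
  define w where "w y x = k * h (midpoint x y) + (- (k * h y / 2) - f y)" for y x
  define v where "v x = (SUP y\<in>C. w y x)" for x
  define u where "u x = k / 2 * h x" for x
  have uw: "u x - w y x = f y + k * midpoint_gap h x y" for x y
    by (simp add: u_def w_def midpoint_gap_def algebra_simps add_divide_distrib)
  have bdd: "bdd_above ((\<lambda>y. w y x) ` C)" if x: "x \<in> C" for x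
  proof (rule bdd_aboveI2)
    fix y assume y: "y \<in> C"
    have "k * h (midpoint x y) \<le> k * M"
      using M[OF convex_midpoint_in[OF cC x y]] k(1) by (intro mult_left_mono) auto
    moreover have "k * - h y \<le> k * M" using M[OF y] k(1) by (intro mult_left_mono) auto
    ultimately show "w y x \<le> k * M + (k * M / 2 + F)"
      using F[OF y] unfolding w_def mult_minus_right abs_le_iff by linarith
  qed
  have w_convex: "convex_on C (w y)" if y: "y \<in> C" for y
    unfolding w_def
  proof (intro convex_on_add convex_on_cmul k(1))
    show "convex_on C (\<lambda>x. h (midpoint x y))"
      unfolding convex_on_def
    proof (intro conjI ballI allI impI cC)
      fix x z and s t :: real assume *: "x \<in> C" "z \<in> C" "0 \<le> s" "0 \<le> t" "s + t = 1"
      have "s *\<^sub>R y + t *\<^sub>R y = y" using * by (simp add: scaleR_add_left[symmetric])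
      then have "midpoint (s *\<^sub>R x + t *\<^sub>R z) y = midpoint (s *\<^sub>R x + t *\<^sub>R z) (s *\<^sub>R y + t *\<^sub>R y)"
        by simp
      also have "\<dots> = s *\<^sub>R midpoint x y + t *\<^sub>R midpoint z y"
        by (simp add: midpoint_def algebra_simps)
      finally show "h (midpoint (s *\<^sub>R x + t *\<^sub>R z) y) \<le> s * h (midpoint x y) + t * h (midpoint z y)"
        using h(1) * convex_midpoint_in[OF cC _ y] unfolding convex_on_def by simp
    qed
  qed (simp add: convex_on_const cC)
  have w_lip: "(k * L)-lipschitz_on C (w y)" if y: "y \<in> C" for y
  proof (rule lipschitz_onI)
    fix x z assume xz: "x \<in> C" "z \<in> C"
    have "midpoint x y - midpoint z y = (1/2) *\<^sub>R (x - z)" by (simp add: midpoint_def algebra_simps)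
    then have "dist (midpoint x y) (midpoint z y) \<le> dist x z" by (simp add: dist_norm)
    then have "L * dist (midpoint x y) (midpoint z y) \<le> L * dist x z"
      using lipschitz_on_nonneg[OF h(2)] by (rule mult_left_mono)
    then have "\<bar>h (midpoint x y) - h (midpoint z y)\<bar> \<le> L * dist x z"
      using lipschitz_onD[OF h(2) convex_midpoint_in[OF cC xz(1) y] convex_midpoint_in[OF cC xz(2) y]]
      by (simp add: dist_real_def)
    then have "k * \<bar>h (midpoint x y) - h (midpoint z y)\<bar> \<le> k * (L * dist x z)"
      using k(1) by (rule mult_left_mono)
    moreover have "dist (w y x) (w y z) = k * \<bar>h (midpoint x y) - h (midpoint z y)\<bar>"
      using k(1) by (simp add: w_def dist_real_def right_diff_distrib[symmetric] abs_mult)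
    ultimately show "dist (w y x) (w y z) \<le> k * L * dist x z" by (simp add: mult.assoc)
  qed (use k(1) lipschitz_on_nonneg[OF h(2)] in simp)
  have v: "convex_on C v" "(k * L)-lipschitz_on C v"
    unfolding v_def using convex_lipschitz_on_SUP[OF C(1) w_convex w_lip bdd] by blast+
  have "convex_on C u" unfolding u_def using h(1) k(1) by (intro convex_on_cmul) auto
  moreover have "(k / 2 * L)-lipschitz_on C u"
    unfolding u_def using h(2) k(1) by (intro lipschitz_on_cmult_real_nonneg) auto
  ultimately have "DC_Lipschitz_on C (\<lambda>x. u x - v x)"
    unfolding DC_Lipschitz_on_def using v by blast
  moreover have "\<bar>f x - (u x - v x)\<bar> \<le> r" if x: "x \<in> C" for x
  proof -
    have "w x x \<le> v x" unfolding v_def using x bdd by (intro cSUP_upper) auto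
    then have upper: "u x - v x \<le> f x" using uw[of x x] by (simp add: midpoint_gap_def)
    have "v x \<le> u x - f x + r"
      unfolding v_def
    proof (rule cSUP_least[OF C(1)])
      fix y assume y: "y \<in> C"
      have gap0: "0 \<le> k * midpoint_gap h x y" using midpoint_gap_nonneg[OF h(1) x y] k(1) by simp
      have "f x - r \<le> f y + k * midpoint_gap h x y"
      proof (cases "midpoint_gap h x y < \<eta>")
        case True
        then show ?thesis using h(4)[OF x y] gap0 by (simp add: abs_le_iff)
      next
        case False
        then have "k * \<eta> \<le> k * midpoint_gap h x y" using k(1) by (intro mult_left_mono) auto
        then show ?thesis using k(2) F[OF x] F[OF y] r by (simp add: abs_le_iff)
      qed
      then show "w y x \<le> u x - f x + r" using uw[of x y] by simp
    qed
    then show ?thesis using upper by simp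
  qed
  ultimately show ?thesis using that by blast
qed

lemma DC_Lipschitz_on_bounded_image:
  assumes "DC_Lipschitz_on C g" "bounded C"
  shows "bounded (g ` C)"
proof -
  obtain u v K L where uv: "K-lipschitz_on C u" "L-lipschitz_on C v" "\<And>x. x \<in> C \<Longrightarrow> g x = u x - v x"
    using assms(1) unfolding DC_Lipschitz_on_def by blast
  have "g ` C = (\<lambda>x. u x - v x) ` C" using uv(3) by auto
  then show ?thesis
    using bounded_minus_comp lipschitz_on_bounded_image[OF uv(1) assms(2)]
      lipschitz_on_bounded_image[OF uv(2) assms(2)] by metis
qed

section \<open>Comparison of the two infima\<close>

theorem theorem5p7:
  fixes C :: "'a::banach set" and f :: "'a \<Rightarrow> real"
  assumes "C \<noteq> {}" and "bounded C" and "closed C" and "convex C"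
    and "uniformly_continuous_on C f"
  shows "eps1 C f / 2 \<le> eps2 C f \<and> eps2 C f \<le> 2 * eps1 C f"
proof -
  define S1 where "S1 = {\<epsilon>. \<epsilon> > 0 \<and> Dz_finite C f \<epsilon>}"
  define S2 where "S2 = {\<epsilon>. \<epsilon> > 0 \<and> (\<exists>g. DC_Lipschitz_on C g \<and> sup_norm_on C (\<lambda>x. f x - g x) < \<epsilon>)}"
  have bf: "bounded (f ` C)" using uniformly_continuous_on_bounded_image assms by blast
  have S1_lower: "Inf S1 \<le> \<epsilon>" if "\<epsilon> \<in> S1" for \<epsilon>
    using that by (intro cInf_lower bdd_belowI[of _ 0]) (auto simp: S1_def)
  have S2_lower: "Inf S2 \<le> \<epsilon>" if "\<epsilon> \<in> S2" for \<epsilon>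
    using that by (intro cInf_lower bdd_belowI[of _ 0]) (auto simp: S2_def)
  have S2_S1: "2 * \<epsilon> \<in> S1" if \<epsilon>: "\<epsilon> \<in> S2" for \<epsilon>
  proof -
    obtain g where g: "\<epsilon> > 0" "DC_Lipschitz_on C g" "sup_norm_on C (\<lambda>x. f x - g x) < \<epsilon>"
      using \<epsilon> unfolding S2_def by blast
    have "bounded ((\<lambda>x. f x - g x) ` C)"
      using bounded_minus_comp[OF bf DC_Lipschitz_on_bounded_image[OF g(2) assms(2)]] .
    then have "bdd_above ((\<lambda>x. \<bar>f x - g x\<bar>) ` C)"
      unfolding bounded_iff by (auto intro: bdd_aboveI2)
    then have "\<bar>f x - g x\<bar> \<le> sup_norm_on C (\<lambda>x. f x - g x)" if "x \<in> C" for x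
      unfolding sup_norm_on_def using that by (intro cSUP_upper)
    from DC_near_imp_gap_controlled[OF assms(1,2) g(2) this g(3)]
    have "Dz_finite C f (2 * \<epsilon>)"
      using gap_controlled_imp_Dz_finite[OF assms(1-4) bf] by blast
    then show ?thesis using g(1) by (simp add: S1_def)
  qed
  have S1_S2: "2 * \<epsilon> + \<delta> \<in> S2" if \<epsilon>: "\<epsilon> \<in> S1" and \<delta>: "\<delta> > 0" for \<epsilon> \<delta>
  proof -
    have "gap_controlled_on C f (2 * \<epsilon> + \<delta> / 2)"
      using Dz_finite_imp_gap_controlled[OF assms(1,4,2,5), of \<epsilon> "\<delta> / 2"] \<epsilon> \<delta> by (simp add: S1_def)
    then obtain g where g: "DC_Lipschitz_on C g" "\<And>x. x \<in> C \<Longrightarrow> \<bar>f x - g x\<bar> \<le> 2 * \<epsilon> + \<delta> / 2"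
      using gap_controlled_imp_DC_near[OF assms(1,2) bf] by blast
    have "sup_norm_on C (\<lambda>x. f x - g x) \<le> 2 * \<epsilon> + \<delta> / 2"
      unfolding sup_norm_on_def using assms(1) g(2) by (intro cSUP_least) auto
    then have "sup_norm_on C (\<lambda>x. f x - g x) < 2 * \<epsilon> + \<delta>" using \<delta> by simp
    then show ?thesis using g(1) \<epsilon> \<delta> by (auto simp: S1_def S2_def)
  qed
  have S2_ne: "S2 \<noteq> {}"
  proof -
    have "DC_Lipschitz_on C (\<lambda>x. 0)"
      unfolding DC_Lipschitz_on_def using assms(4)
      by (intro exI[of _ "\<lambda>x. 0"]) (auto simp: convex_on_const intro: lipschitz_on_constant)
    then have "max 1 (sup_norm_on C (\<lambda>x. f x - 0) + 1) \<in> S2" unfolding S2_def by fastforce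
    then show ?thesis by blast
  qed
  then have S1_ne: "S1 \<noteq> {}" using S2_S1 by blast
  have "Inf S1 / 2 \<le> Inf S2"
  proof (rule cInf_greatest[OF S2_ne])
    fix \<epsilon> assume "\<epsilon> \<in> S2"
    then show "Inf S1 / 2 \<le> \<epsilon>" using S1_lower[OF S2_S1] by force
  qed
  moreover have "Inf S2 / 2 \<le> Inf S1"
  proof (rule cInf_greatest[OF S1_ne])
    fix \<epsilon> assume \<epsilon>: "\<epsilon> \<in> S1"
    have "Inf S2 \<le> 2 * \<epsilon>" using S2_lower[OF S1_S2[OF \<epsilon>]] by (rule field_le_epsilon)
    then show "Inf S2 / 2 \<le> \<epsilon>" by simp
  qed
  ultimately show ?thesis unfolding eps1_def eps2_def S1_def[symmetric] S2_def[symmetric] by simp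
qed

end
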